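(* Let $R$ be a supertropical domain and $n\ge1$. For every matrix $A\in M_n(R)$, $$\bigl(A\operatorname{adj}(A)\bigr)^2=|A|\;A\operatorname{adj}(A).$$
   Context: A supertropical semiring $(R,\mathcal G_0,\nu)$ is a commutative semiring $R$ with unit $\mathbb 1$ and zero $\mathbb 0$ (with $\mathbb 0 r=\mathbb 0$ for all $r$), a semiring ideal $\mathcal G_0=\mathcal G\cup\{\mathbb 0\}$ (the ghost ideal, where $\mathcal G=\mathcal G_0\setminus\{\mathbb 0\}$), and an idempotent map $\nu:R\to\mathcal G_0$, written $a^\nu=\nu(a)$, preserving addition and multiplication, given by $\nu(a)=a+a$ and equal to the identity on $\mathcal G_0$, such that $a+b=a^\nu$ if $a^\nu=b^\nu$, and $a+b\in\{a,b\}$ if $a^\nu\ne b^\nu$. $\mathcal G_0$ is totally ordered by $a^\nu\le b^\nu$ iff $a^\nu+b^\nu=b^\nu$. Tangible elements: $\mathcal T=R\setminus\mathcal G_0$. It is a supertropical domain if $\mathcal T$ is a multiplicative monoid (closed under multiplication, containing $\mathbb 1$) and $\nu|_{\mathcal T}:\mathcal T\to\mathcal G$ is onto. Tropical determinant: $|A|=\sum_{\pi\in S_n}a_{1,\pi(1)}\cdots a_{n,\pi(n)}$ (the empty determinant is $\mathbb 1$). $\operatorname{adj}(A)$ is the transpose of $(a'_{i,j})$, where $a'_{i,j}$ is the tropical determinant of the matrix obtained from $A$ by deleting row $i$ and column $j$ (no signs). *)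

theory Defs
  imports "Jordan_Normal_Form.Determinant"
begin

(* The semiring R is the whole type 'a.  The class comm_semiring_1 includes 0 \<noteq> 1, which every
   supertropical domain satisfies, since 0 is a ghost and 1 is tangible. *)
locale supertropical_semiring =
  fixes G0 :: "'a :: comm_semiring_1 set"
    and nu :: "'a \<Rightarrow> 'a"
  assumes zero_ghost: "0 \<in> G0"
    and ghost_add: "\<lbrakk>a \<in> G0; b \<in> G0\<rbrakk> \<Longrightarrow> a + b \<in> G0"
    and ghost_mult: "a \<in> G0 \<Longrightarrow> r * a \<in> G0"
    and nu_ghost: "nu a \<in> G0"
    and nu_idem: "nu (nu a) = nu a"
    and nu_add: "nu (a + b) = nu a + nu b"
    and nu_mult: "nu (a * b) = nu a * nu b"
    and nu_double: "nu a = a + a"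
    and nu_on_ghost: "a \<in> G0 \<Longrightarrow> nu a = a"
    and add_same_nu: "nu a = nu b \<Longrightarrow> a + b = nu a"
    and add_diff_nu: "nu a \<noteq> nu b \<Longrightarrow> a + b \<in> {a, b}"
begin

definition ghosts :: "'a set" where
  "ghosts = G0 - {0}"

definition tangibles :: "'a set" where
  "tangibles = UNIV - G0"

(* The total order on the ghost ideal need not be postulated. *)
lemma ghost_order: "linear_order_on G0 {(a, b). a \<in> G0 \<and> b \<in> G0 \<and> a + b = b}"
proof -
  have "a + a = a" if "a \<in> G0" for a
    using that nu_double nu_on_ghost by metis
  moreover have "a + b = b \<or> b + a = a" if "a \<in> G0" "b \<in> G0" for a b
    using that add_diff_nu[of a b] calculation[of a] by (metis add.commute insert_iff nu_on_ghost singletonD)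
  moreover have "a + c = c" if "a + b = b" "b + c = c" for a b c :: 'a
    using that by (metis add.assoc)
  ultimately show ?thesis
    unfolding linear_order_on_def partial_order_on_def preorder_on_def refl_on_def
      trans_def antisym_def total_on_def
    by (auto simp: add.commute)
qed

end

locale supertropical_domain = supertropical_semiring +
  assumes one_tangible: "1 \<in> tangibles"
    and tangible_mult: "\<lbrakk>a \<in> tangibles; b \<in> tangibles\<rbrakk> \<Longrightarrow> a * b \<in> tangibles"
    and nu_onto: "nu ` tangibles = ghosts"

(* Rows and columns are numbered from 0.  As for the library's det, a non-square matrix has the
   junk value 0; for the matrix of dimension 0 the value is 1. *)
definition trop_det :: "'a :: comm_semiring_1 mat \<Rightarrow> 'a" where
  "trop_det A = (if dim_row A = dim_col A
     then (\<Sum>p | p permutes {0..<dim_row A}. \<Prod>i = 0..<dim_row A. A $$ (i, p i)) else 0)"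

definition trop_adj :: "'a :: comm_semiring_1 mat \<Rightarrow> 'a mat" where
  "trop_adj A = transpose_mat
     (mat (dim_row A) (dim_col A) (\<lambda>(i, j). trop_det (mat_delete A i j)))"

end

theory Submission
  imports Defs
begin

text \<open>
  In a supertropical semiring \<open>1 + 1 + 1 = 1 + 1\<close>, so a sum does not change when a term is added
  that already occurs in it twice (\<open>sum_absorbs_repeated_term\<close>). The identity holds over every
  commutative semiring with this property, and the rest of the proof compares monomials.

  The tropical determinant is a permanent. By Laplace expansion along row \<open>j\<close>, the entry
  \<open>(i, j)\<close> of \<open>B = A * trop_adj A\<close> is the permanent of \<open>A\<close> with row \<open>j\<close> replaced by row \<open>i\<close>
  (\<open>mult_trop_adj_index\<close>). In particular the diagonal entries are \<open>trop_det A\<close>, so the summand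
  \<open>k = i\<close> of \<open>(B * B) $$ (i, j)\<close> is \<open>Y = trop_det A * B $$ (i, j)\<close>. What remains is that
  \<open>Y\<close> absorbs every summand \<open>B $$ (i, k) * B $$ (k, j)\<close> with \<open>k \<noteq> i\<close>
  (\<open>mult_permanent_absorbs_mult_permanent\<close>).

  This needs two facts. First, every monomial of that summand is a monomial of \<open>Y\<close>: together the
  two factors use row \<open>j\<close> of \<open>A\<close> once less and row \<open>i\<close> once more than \<open>A\<close> taken twice, and so do
  the two factors of \<open>Y\<close>; a pair of permutations for the former becomes one for the latter by
  exchanging the two permutations on a set of positions that contains \<open>k\<close> but not \<open>j\<close>, on which
  they take the same values (\<open>exchange_rows\<close>). Secondly, the monomial occurs twice in \<open>Y\<close>
  (\<open>mult_permanent_absorbs_term\<close>): for \<open>i \<noteq> j\<close> because the second factor has two equal rows, and for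
  \<open>i = j\<close> because \<open>Y\<close> is a square and the two permutations of the monomial differ.
\<close>

section \<open>Absorption of repeated terms\<close>

lemma add_sum_absorb:
  fixes y :: "'a :: comm_monoid_add"
  assumes "\<And>t. t \<in> T \<Longrightarrow> y + f t = y"
  shows "y + sum f T = y"
  using assms
  by (induction T rule: infinite_finite_induct) (simp_all add: add.assoc[symmetric])

lemma sum_absorbs_repeated_term:
  fixes f :: "'b \<Rightarrow> 'a :: comm_semiring_1"
  assumes three: "(1::'a) + 1 + 1 = 1 + 1"
    and "finite I" "a \<in> I" "b \<in> I" "a \<noteq> b" "f b = f a"
  shows "sum f I + f a = sum f I"
proof -
  have "f a * (1 + 1 + 1) = f a * (1 + 1)"
    by (simp only: three)
  then have triple: "f a + f a + f a = f a + f a"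
    by (simp only: distrib_left mult_1_right)
  have "sum f I = f a + (f b + sum f (I - {a} - {b}))"
    using assms by (simp add: sum.remove[of I a] sum.remove[of "I - {a}" b])
  then have "sum f I = (f a + f a) + sum f (I - {a} - {b})"
    using assms by (simp add: add.assoc)
  then show ?thesis
    using triple by (metis add.assoc add.commute)
qed

section \<open>Permanents\<close>

definition diag_prod :: "'b set \<Rightarrow> ('b \<Rightarrow> 'b \<Rightarrow> 'a :: comm_semiring_1) \<Rightarrow> ('b \<Rightarrow> 'b) \<Rightarrow> 'a" where
  "diag_prod S g p = (\<Prod>x\<in>S. g x (p x))"

definition permanent :: "'b set \<Rightarrow> ('b \<Rightarrow> 'b \<Rightarrow> 'a :: comm_semiring_1) \<Rightarrow> 'a" where
  "permanent S g = (\<Sum>p | p permutes S. diag_prod S g p)"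

lemma permanent_mult_permanent:
  "permanent S g * permanent S h =
     (\<Sum>(p, q) \<in> {p. p permutes S} \<times> {q. q permutes S}. diag_prod S g p * diag_prod S h q)"
  unfolding permanent_def by (simp add: sum_product sum.cartesian_product)

lemma diag_prod_permute_rows:
  assumes "t permutes S"
  shows "diag_prod S (\<lambda>x. g (t x)) (p \<circ> t) = diag_prod S g p"
  unfolding diag_prod_def
  using prod.permute[OF assms, of "\<lambda>x. g x (p x)"] by (simp add: comp_def)

text \<open>
  The permutations that send \<open>i\<close> to \<open>l\<close> correspond to those of one element less, by deleting \<open>i\<close>
  from the domain and \<open>l\<close> from the range; grouping the permutations by \<open>l\<close> gives the expansion.
\<close>

lemma permanent_laplace_row:
  fixes g :: "nat \<Rightarrow> nat \<Rightarrow> 'a :: comm_semiring_1"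
  assumes i: "i < Suc m"
  shows "permanent {0..<Suc m} g =
    (\<Sum>l = 0..<Suc m. g i l *
      permanent {0..<m} (\<lambda>x y. g (insert_index i x) (insert_index l y)))"
proof -
  have split_off: "diag_prod {0..<Suc m} g (permutation_insert i l q) =
      g i l * diag_prod {0..<m} (\<lambda>x y. g (insert_index i x) (insert_index l y)) q"
    for l q
  proof -
    let ?p = "permutation_insert i l q"
    have p_at: "?p (insert_index i x) = insert_index l (q x)" for x
      by (cases "x < i") (simp_all add: permutation_insert_expand insert_index_def)
    have "diag_prod {0..<Suc m} g ?p = g i l * (\<Prod>x \<in> {0..<Suc m} - {i}. g x (?p x))"
      unfolding diag_prod_def using i by (subst prod.remove[of _ i]) simp_all
    also have "{0..<Suc m} - {i} = insert_index i ` {0..<m}"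
      using i by (simp add: insert_index_image)
    also have "(\<Prod>x \<in> insert_index i ` {0..<m}. g x (?p x)) =
        (\<Prod>x = 0..<m. g (insert_index i x) (insert_index l (q x)))"
      by (subst prod.reindex[OF insert_index_inj_on]) (simp add: p_at)
    finally show ?thesis by (simp add: diag_prod_def)
  qed
  let ?P = "{p. p permutes {0..<Suc m}}"
  have "permanent {0..<Suc m} g =
      (\<Sum>l = 0..<Suc m. \<Sum>p | p \<in> ?P \<and> p i = l. diag_prod {0..<Suc m} g p)"
    unfolding permanent_def
  proof (rule sum.group[symmetric])
    show "(\<lambda>p. p i) ` ?P \<subseteq> {0..<Suc m}"
      using i permutes_in_image by fastforce
  qed (simp_all add: finite_permutations)
  also have "\<dots> = (\<Sum>l = 0..<Suc m. g i l *
      permanent {0..<m} (\<lambda>x y. g (insert_index i x) (insert_index l y)))"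
  proof (rule sum.cong[OF refl])
    fix l assume "l \<in> {0..<Suc m}"
    then have l: "l < Suc m" by simp
    have "(\<Sum>p | p \<in> ?P \<and> p i = l. diag_prod {0..<Suc m} g p) =
        (\<Sum>q | q permutes {0..<m}. diag_prod {0..<Suc m} g (permutation_insert i l q))"
      using permutation_fix[OF i l]
      by (simp add: sum.reindex[OF permutation_insert_inj_on[OF i l]])
    then show "(\<Sum>p | p \<in> ?P \<and> p i = l. diag_prod {0..<Suc m} g p) =
        g i l * permanent {0..<m} (\<lambda>x y. g (insert_index i x) (insert_index l y))"
      by (simp add: split_off permanent_def sum_distrib_left)
  qed
  finally show ?thesis .
qed

section \<open>Exchanging parts of two permutations\<close>

definition splice :: "'b set \<Rightarrow> ('b \<Rightarrow> 'c) \<Rightarrow> ('b \<Rightarrow> 'c) \<Rightarrow> 'b \<Rightarrow> 'c" where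
  "splice C q p x = (if x \<in> C then q x else p x)"

lemma splice_permutes:
  assumes p: "p permutes S" and q: "q permutes S" and S: "finite S"
    and C: "C \<subseteq> S" and image: "p ` C = q ` C"
  shows "splice C q p permutes S"
proof (rule bij_imp_permutes)
  have clash: False if "x \<in> C" "y \<notin> C" "q x = p y" for x y
  proof -
    from that image obtain c where "c \<in> C" "p c = p y" by (metis imageE imageI)
    with that show False using permutes_inj[OF p] by (auto dest: injD)
  qed
  have "inj_on (splice C q p) S"
    using clash permutes_inj[OF p] permutes_inj[OF q]
    by (intro inj_onI) (auto simp: splice_def dest: injD clash sym split: if_splits)
  moreover have "splice C q p ` S \<subseteq> S"
    using permutes_in_image[OF p] permutes_in_image[OF q] by (auto simp: splice_def)
  ultimately show "bij_betw (splice C q p) S S"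
    using S by (simp add: bij_betw_def endo_inj_surj)
next
  show "splice C q p x = x" if "x \<notin> S" for x
    using that C permutes_not_in[OF p] by (auto simp: splice_def)
qed

lemma diag_prod_splice:
  assumes "finite S"
  shows "diag_prod S g p * diag_prod S h q =
    diag_prod S (splice C h g) (splice C q p) * diag_prod S (splice C g h) (splice C p q)"
  unfolding diag_prod_def prod.distrib[symmetric]
  by (rule prod.cong) (auto simp: splice_def mult.commute)

text \<open>
  On a union of cycles of \<open>f = q\<inverse> \<circ> p\<close> the permutations \<open>p\<close> and \<open>q\<close> have the same image, so the
  cycle of \<open>k\<close> serves as \<open>C\<close> unless it contains \<open>j\<close>. In that case, replacing \<open>q\<close> by
  \<open>q \<circ> transpose k j\<close> composes \<open>f\<close> with this transposition, which splits the cycle into two and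
  separates \<open>k\<close> from \<open>j\<close>. Both cases use the same set: the iterates of \<open>f\<close> from \<open>k\<close> up to the
  first return to \<open>{k, j}\<close>.
\<close>

lemma separating_common_image:
  assumes p: "p permutes S" and q: "q permutes S" and S: "finite S"
    and k: "k \<in> S" and j: "j \<in> S" and kj: "k \<noteq> j"
  obtains C q' where "q' = q \<or> q' = q \<circ> transpose k j" "q' permutes S"
    "C \<subseteq> S" "k \<in> C" "j \<notin> C" "p ` C = q' ` C"
proof -
  define f where "f = inv_into UNIV q \<circ> p"
  have f: "f permutes S"
    unfolding f_def by (intro permutes_compose p permutes_inv q)
  have qf: "q (f x) = p x" for x
    unfolding f_def using permutes_inverses(1)[OF q] by simp
  have iter_S: "(f ^^ l) k \<in> S" for l
    by (induction l) (simp_all add: k permutes_in_image[OF f])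
  have "\<exists>m>0. (f ^^ m) k = k"
  proof (rule funpow_inj_finite[OF permutes_inj[OF f], of k])
    show "finite {y. \<exists>n. y = (f ^^ n) k}"
      by (rule finite_subset[OF _ S]) (use iter_S in auto)
  qed auto
  then have ex: "\<exists>m. 0 < m \<and> (f ^^ m) k \<in> {k, j}" by auto
  define m where "m = (LEAST m. 0 < m \<and> (f ^^ m) k \<in> {k, j})"
  have m: "0 < m" "(f ^^ m) k \<in> {k, j}"
    using LeastI_ex[OF ex] unfolding m_def by auto
  have before: "(f ^^ l) k \<notin> {k, j}" if "0 < l" "l < m" for l
    using not_less_Least[of l "\<lambda>m. 0 < m \<and> (f ^^ m) k \<in> {k, j}"] that unfolding m_def by auto
  define C where "C = (\<lambda>l. (f ^^ l) k) ` {..<m}"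
  define q' where "q' = (if (f ^^ m) k = k then q else q \<circ> transpose k j)"
  have q': "q' permutes S"
    unfolding q'_def using q permutes_swap_id[OF k j] by (simp add: permutes_compose)
  have C: "C \<subseteq> S" unfolding C_def using iter_S by auto
  have kC: "k \<in> C" unfolding C_def using m(1) by (force intro: image_eqI[of _ _ 0])
  have jC: "j \<notin> C"
  proof
    assume "j \<in> C"
    then obtain l where "l < m" "(f ^^ l) k = j" unfolding C_def by auto
    then show False using before[of l] kj by (cases "l = 0") auto
  qed
  have "p ` C \<subseteq> q' ` C"
  proof
    fix y assume "y \<in> p ` C"
    then obtain l where l: "l < m" and y: "y = p ((f ^^ l) k)" unfolding C_def by auto
    then have y_qf: "y = q ((f ^^ Suc l) k)" by (simp add: qf)
    show "y \<in> q' ` C"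
    proof (cases "Suc l < m")
      case True
      then have "(f ^^ Suc l) k \<in> C" "(f ^^ Suc l) k \<notin> {k, j}"
        using before[of "Suc l"] unfolding C_def by blast+
      moreover from this(2) have "q' ((f ^^ Suc l) k) = y"
        unfolding q'_def y_qf by (simp add: transpose_def)
      ultimately show ?thesis by blast
    next
      case False
      with l have "Suc l = m" by simp
      then have "q' k = y"
        using m(2) y_qf unfolding q'_def by auto
      then show ?thesis using kC by blast
    qed
  qed
  \<comment> \<open>Both images have as many elements as \<open>C\<close>, so the inclusion is an equality.\<close>
  moreover have "card (p ` C) = card (q' ` C)"
    using card_image[OF permutes_inj_on[OF p]] card_image[OF permutes_inj_on[OF q']] by simp
  ultimately have "p ` C = q' ` C"
    using finite_subset[OF C S] by (intro card_subset_eq) auto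
  moreover have "q' = q \<or> q' = q \<circ> transpose k j"
    by (simp add: q'_def)
  ultimately show thesis
    using that q' C kC jC by blast
qed

section \<open>Exchanging rows between two permanents\<close>

definition replace_row :: "('b \<Rightarrow> 'b \<Rightarrow> 'a) \<Rightarrow> 'b \<Rightarrow> 'b \<Rightarrow> 'b \<Rightarrow> 'b \<Rightarrow> 'a" where
  "replace_row g j i = g(j := g i)"

lemma replace_row_same [simp]: "replace_row g i i = g"
  by (simp add: replace_row_def)

text \<open>
  Read position by position, the two factors on the left have the same rows except at \<open>k\<close>, where
  they have \<open>i\<close> and \<open>k\<close>, and at \<open>j\<close>, where they have \<open>j\<close> and \<open>k\<close>. Exchanging them on a set
  containing \<open>k\<close> but not \<open>j\<close> gives the first factor its row \<open>k\<close> back and makes it \<open>g\<close>. The second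
  factor then has row \<open>i\<close> at position \<open>k\<close> and row \<open>k\<close> at position \<open>j\<close>, which is
  \<open>replace_row g j i\<close> with these two positions transposed.
\<close>

lemma exchange_rows:
  fixes g :: "'b \<Rightarrow> 'b \<Rightarrow> 'a :: comm_semiring_1"
  assumes S: "finite S" and i: "i \<in> S" and j: "j \<in> S" and k: "k \<in> S"
    and ki: "k \<noteq> i" and kj: "k \<noteq> j"
    and p: "p permutes S" and q: "q permutes S"
  obtains u v where "u permutes S" "v permutes S" "i = j \<Longrightarrow> u \<noteq> v"
    "diag_prod S (replace_row g k i) p * diag_prod S (replace_row g j k) q =
     diag_prod S g u * diag_prod S (replace_row g j i) v"
proof -
  let ?t = "transpose k j"
  have t: "?t permutes S" by (rule permutes_swap_id[OF k j])
  obtain C q' where q'_cases: "q' = q \<or> q' = q \<circ> ?t" and q': "q' permutes S"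
    and C: "C \<subseteq> S" "k \<in> C" "j \<notin> C" and image: "p ` C = q' ` C"
    by (rule separating_common_image[OF p q S k j kj])
  \<comment> \<open>Rows \<open>k\<close> and \<open>j\<close> of \<open>replace_row g j k\<close> are equal, so passing from \<open>q\<close> to \<open>q'\<close> is harmless.\<close>
  have "(\<lambda>x. replace_row g j k (?t x)) = replace_row g j k"
    by (auto simp: replace_row_def transpose_def fun_eq_iff)
  then have q_q': "diag_prod S (replace_row g j k) q = diag_prod S (replace_row g j k) q'"
    using q'_cases diag_prod_permute_rows[OF t, of "replace_row g j k" q] by auto
  define u where "u = splice C q' p"
  define w where "w = splice C p q'"
  have u: "u permutes S" and w: "w permutes S"
    unfolding u_def w_def using splice_permutes p q' S C(1) image by metis+
  have first: "splice C (replace_row g j k) (replace_row g k i) = g"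
    using C by (auto simp: splice_def replace_row_def fun_eq_iff)
  have second: "splice C (replace_row g k i) (replace_row g j k) =
      (\<lambda>x. replace_row g j i (?t x))"
    using C kj ki by (auto simp: splice_def replace_row_def transpose_def fun_eq_iff)
  have "diag_prod S (replace_row g k i) p * diag_prod S (replace_row g j k) q' =
      diag_prod S g u * diag_prod S (\<lambda>x. replace_row g j i (?t x)) w"
    unfolding u_def w_def
    by (subst diag_prod_splice[OF S, where C = C]) (simp only: first second)
  also have "diag_prod S (\<lambda>x. replace_row g j i (?t x)) w =
      diag_prod S (replace_row g j i) (w \<circ> ?t)"
    using diag_prod_permute_rows[OF t, of "replace_row g j i" "w \<circ> ?t"]
    by (simp add: comp_assoc)
  finally have "diag_prod S (replace_row g k i) p * diag_prod S (replace_row g j k) q =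
      diag_prod S g u * diag_prod S (replace_row g j i) (w \<circ> ?t)"
    by (simp add: q_q')
  moreover have "w \<circ> ?t permutes S" by (rule permutes_compose[OF t w])
  moreover have "u \<noteq> w \<circ> ?t" if "i = j"
  proof
    assume eq: "u = w \<circ> ?t"
    have "p j = u j" using C by (simp add: u_def splice_def)
    also have "u j = w k" using eq by simp
    also have "w k = p k" using C by (simp add: w_def splice_def)
    finally show False using kj permutes_inj[OF p] by (auto dest: injD)
  qed
  ultimately show thesis using that u by blast
qed

text \<open>
  The monomial at \<open>(u, v)\<close> has a second occurrence. For \<open>i = j\<close> both factors are the permanent of \<open>g\<close>
  and it is the one at \<open>(v, u)\<close>; otherwise rows \<open>i\<close> and \<open>j\<close> of the second matrix coincide and it is
  the one at \<open>(u, v \<circ> transpose i j)\<close>.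
\<close>

lemma mult_permanent_absorbs_term:
  fixes g :: "'b \<Rightarrow> 'b \<Rightarrow> 'a :: comm_semiring_1"
  assumes three: "(1::'a) + 1 + 1 = 1 + 1"
    and S: "finite S" and i: "i \<in> S" and j: "j \<in> S"
    and u: "u permutes S" and v: "v permutes S" and uv: "i = j \<Longrightarrow> u \<noteq> v"
  shows "permanent S g * permanent S (replace_row g j i) +
      diag_prod S g u * diag_prod S (replace_row g j i) v =
    permanent S g * permanent S (replace_row g j i)"
proof -
  let ?P = "{p. p permutes S}"
  let ?f = "\<lambda>(u, v). diag_prod S g u * diag_prod S (replace_row g j i) v"
  let ?t = "transpose i j"
  have t: "?t permutes S" by (rule permutes_swap_id[OF i j])
  obtain u' v' where "u' permutes S" "v' permutes S" "(u, v) \<noteq> (u', v')"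
    "?f (u', v') = ?f (u, v)"
  proof (cases "i = j")
    case True
    then show thesis using that[of v u] u v uv by (simp add: mult.commute)
  next
    case False
    have rows: "(\<lambda>x. replace_row g j i (?t x)) = replace_row g j i"
      by (auto simp: replace_row_def transpose_def fun_eq_iff)
    have "v i \<noteq> v j" using False permutes_inj[OF v] by (auto dest: injD)
    then have "v \<noteq> v \<circ> ?t" by (metis comp_apply transpose_apply_first)
    moreover have "v \<circ> ?t permutes S" by (rule permutes_compose[OF t v])
    moreover have "?f (u, v \<circ> ?t) = ?f (u, v)"
      using diag_prod_permute_rows[OF t, of "replace_row g j i" v] by (simp add: rows)
    ultimately show thesis using that[of u "v \<circ> ?t"] u by simp
  qed
  then have "sum ?f (?P \<times> ?P) + ?f (u, v) = sum ?f (?P \<times> ?P)"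
    using u v
    by (intro sum_absorbs_repeated_term[OF three, of _ _ "(u', v')"])
       (simp_all add: finite_permutations[OF S])
  then show ?thesis by (simp add: permanent_mult_permanent)
qed

lemma mult_permanent_absorbs_mult_permanent:
  fixes g :: "'b \<Rightarrow> 'b \<Rightarrow> 'a :: comm_semiring_1"
  assumes three: "(1::'a) + 1 + 1 = 1 + 1"
    and S: "finite S" and i: "i \<in> S" and j: "j \<in> S" and k: "k \<in> S" and ki: "k \<noteq> i"
  shows "permanent S g * permanent S (replace_row g j i) +
      permanent S (replace_row g k i) * permanent S (replace_row g j k) =
    permanent S g * permanent S (replace_row g j i)"
  unfolding permanent_mult_permanent[of S "replace_row g k i"]
proof (rule add_sum_absorb, clarsimp)
  fix p q assume p: "p permutes S" and q: "q permutes S"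
  obtain u v where u: "u permutes S" and v: "v permutes S" and uv: "i = j \<Longrightarrow> u \<noteq> v"
    and eq: "diag_prod S (replace_row g k i) p * diag_prod S (replace_row g j k) q =
     diag_prod S g u * diag_prod S (replace_row g j i) v"
  proof (cases "k = j")
    case True
    \<comment> \<open>Here the left factors are those on the right in reverse order.\<close>
    then show thesis using that[of q p] p q ki by (simp add: mult.commute)
  next
    case False
    then show thesis by (rule exchange_rows[OF S i j k ki _ p q, of g]) (rule that)
  qed
  show "permanent S g * permanent S (replace_row g j i) +
      diag_prod S (replace_row g k i) p * diag_prod S (replace_row g j k) q =
    permanent S g * permanent S (replace_row g j i)"
    unfolding eq by (rule mult_permanent_absorbs_term[OF three S i j u v uv])
qed

section \<open>The product of a matrix with its adjoint\<close>

lemma trop_det_eq_permanent: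
  assumes "A \<in> carrier_mat n n"
  shows "trop_det A = permanent {0..<n} (\<lambda>x y. A $$ (x, y))"
  using assms unfolding trop_det_def permanent_def diag_prod_def by simp

text \<open>
  The minors in column \<open>j\<close> of the adjoint omit row \<open>j\<close> of \<open>A\<close>, so they are also the minors along
  row \<open>j\<close> of the matrix with row \<open>j\<close> replaced; the entry is its Laplace expansion.
\<close>

lemma mult_trop_adj_index:
  assumes A: "A \<in> carrier_mat n n" and i: "i < n" and j: "j < n"
  shows "(A * trop_adj A) $$ (i, j) =
    permanent {0..<n} (replace_row (\<lambda>x y. A $$ (x, y)) j i)"
proof -
  let ?g = "\<lambda>x y. A $$ (x, y)"
  obtain m where n: "n = Suc m" using i by (cases n) auto
  have minor: "trop_det (mat_delete A j l) =
      permanent {0..<m} (\<lambda>x y. replace_row ?g j i (insert_index j x) (insert_index l y))"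
    if l: "l < n" for l
  proof -
    have D: "mat_delete A j l \<in> carrier_mat m m"
      using A n by (auto simp: mat_delete_def)
    have "mat_delete A j l $$ (x, p x) =
        replace_row ?g j i (insert_index j x) (insert_index l (p x))"
      if "p permutes {0..<m}" "x \<in> {0..<m}" for p x
    proof -
      have "x < m" "p x < m" using that permutes_in_image[OF that(1), of x] by auto
      then show ?thesis
        using A j l n by (simp add: mat_delete_index replace_row_def)
    qed
    then show ?thesis
      unfolding trop_det_eq_permanent[OF D] permanent_def diag_prod_def
      by (intro sum.cong prod.cong refl) auto
  qed
  have "(A * trop_adj A) $$ (i, j) = (\<Sum>l = 0..<n. A $$ (i, l) * trop_det (mat_delete A j l))"
    using A i j by (simp add: trop_adj_def scalar_prod_def)
  also have "\<dots> = (\<Sum>l = 0..<n. replace_row ?g j i j l *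
      permanent {0..<m} (\<lambda>x y. replace_row ?g j i (insert_index j x) (insert_index l y)))"
    by (intro sum.cong refl) (simp add: minor replace_row_def)
  also have "\<dots> = permanent {0..<n} (replace_row ?g j i)"
    using permanent_laplace_row[of j m "replace_row ?g j i"] j n by simp
  finally show ?thesis .
qed

lemma mult_trop_adj_square:
  fixes A :: "'a :: comm_semiring_1 mat"
  assumes three: "(1::'a) + 1 + 1 = 1 + 1" and A: "A \<in> carrier_mat n n"
  shows "(A * trop_adj A) * (A * trop_adj A) = trop_det A \<cdot>\<^sub>m (A * trop_adj A)"
proof -
  let ?g = "\<lambda>x y. A $$ (x, y)"
  define B where "B = A * trop_adj A"
  have B: "B \<in> carrier_mat n n"
    using A by (auto simp: B_def trop_adj_def)
  have entry: "B $$ (i, j) = permanent {0..<n} (replace_row ?g j i)" if "i < n" "j < n" for i j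
    unfolding B_def by (rule mult_trop_adj_index[OF A that])
  have det: "trop_det A = permanent {0..<n} ?g"
    by (rule trop_det_eq_permanent[OF A])
  have "(\<Sum>k = 0..<n. B $$ (i, k) * B $$ (k, j)) = trop_det A * B $$ (i, j)"
    if i: "i < n" and j: "j < n" for i j
  proof -
    let ?Y = "trop_det A * B $$ (i, j)"
    have "B $$ (i, i) = trop_det A"
      using i by (simp add: entry det)
    then have "(\<Sum>k = 0..<n. B $$ (i, k) * B $$ (k, j)) =
        ?Y + (\<Sum>k \<in> {0..<n} - {i}. B $$ (i, k) * B $$ (k, j))"
      using i by (subst sum.remove[of _ i]) simp_all
    also have "\<dots> = ?Y"
    proof (rule add_sum_absorb)
      fix k assume "k \<in> {0..<n} - {i}"
      then show "?Y + B $$ (i, k) * B $$ (k, j) = ?Y"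
        using mult_permanent_absorbs_mult_permanent[OF three, of "{0..<n}" i j k ?g] i j
        by (simp add: entry det)
    qed
    finally show ?thesis .
  qed
  then have "B * B = trop_det A \<cdot>\<^sub>m B"
    using B by (intro eq_matI) (auto simp: scalar_prod_def)
  then show ?thesis by (simp add: B_def)
qed

text \<open>
  The elements \<open>nu 1\<close> and \<open>1\<close> have the same ghost value, so their sum is that value, \<open>nu 1 = 1 + 1\<close>.
\<close>

lemma (in supertropical_semiring) one_plus_one_plus_one: "(1::'a) + 1 + 1 = 1 + 1"
  using add_same_nu[of "nu 1" 1] nu_idem[of 1] nu_double[of 1] by simp

theorem theorem4p12:
  fixes G0 :: "'a :: comm_semiring_1 set"
    and nu :: "'a \<Rightarrow> 'a"
    and A :: "'a mat"
    and n :: nat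
  assumes "supertropical_domain G0 nu"
    and "n \<ge> 1"
    and "A \<in> carrier_mat n n"
  shows "(A * trop_adj A) ^\<^sub>m 2 = trop_det A \<cdot>\<^sub>m (A * trop_adj A)"
proof -
  interpret supertropical_domain G0 nu by fact
  have "A * trop_adj A \<in> carrier_mat n n"
    using assms(3) by (auto simp: trop_adj_def)
  then have "(A * trop_adj A) ^\<^sub>m 2 = (A * trop_adj A) * (A * trop_adj A)"
    by (simp add: numeral_2_eq_2)
  then show ?thesis
    using mult_trop_adj_square[OF one_plus_one_plus_one assms(3)] by simp
qed

end
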